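(* In online matching with online items and non-myopic offline agents with public graph edges, every prompt randomized truthful mechanism has competitive ratio at least $\Omega(\log\nu/\log\log\nu)$, where $\nu=\min(m,n)$, $n$ is the number of buyers and $m$ the number of items (the implied constant is absolute and the asymptotics are as $\nu\to\infty$).
   Context: Model. There is a bipartite graph $G=(B,I;E)$ with a set $B$ of $n$ buyers, known in advance, and a set $I$ of $m$ items arriving one by one in an unknown, possibly adversarial order (item $j$ arrives at time $j$). Buyer $i$ is interested in the items $j$ with $(i,j)\in E$, and has a private value $v_i\ge 0$ for obtaining at least one item she is interested in (value $0$ otherwise). Public graph edges: when item $j$ arrives, the true set of buyers interested in $j$ is revealed to the mechanism (buyers cannot misreport edges); the only private information of buyer $i$ is $v_i$, and her report is a single value $b_i$ which she cannot change once declared. A mechanism, possibly randomized, decides upon the arrival of $j$, immediately and irrevocably and using only information on items up to $j$, either to assign $j$ to a buyer interested in it who has not been assigned an item yet, or to leave $j$ unassigned forever. The result is a (random) matching $\mu$ ($\mu^{-1}_i$ is the item received by $i$, $\emptyset$ if none). The mechanism also charges non-negative payments $p_i$; it is prompt if $p_i$ is determined upon the arrival of the item assigned to $i$, using only information available at that time. Welfare. $\mathrm{SW}(\mu)=\sum_{i\in B} v_i\cdot \mathbb{I}[(i,\mu^{-1}_i)\in E]$, and $\mathrm{OPT}=\mathrm{SW}(\mu^\star)$ where $\mu^\star$ is a maximum weight matching in $G$. A mechanism is $\alpha$-competitive ($\alpha\ge 1$) on instances with $n$ buyers and $m$ items if $\mathrm{OPT}\le\alpha\cdot \mathbb{E}[\mathrm{SW}(\mu)]$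 on all such instances (with truthful reports); its competitive ratio is the infimum of such $\alpha$ ($+\infty$ if none exists). Truthfulness. Non-myopic buyers know the whole sequence of items and maximize the quasi-linear utility $u_i=v_i\cdot\mathbb{I}[(i,\mu_i^{-1})\in E]-p_i$. A mechanism is truthful (in the ex-post sense) if, for every realization of the mechanism's random choices, every instance and every behavior of the other buyers, each agent maximizes her utility by reporting truthfully; thus a randomized truthful mechanism is a probability distribution over deterministic truthful mechanisms. Mechanisms are required to be ex-post individually rational: truthful agents have non-negative utility in every realization. *)

theory Defs
  imports "HOL-Probability.Probability"
begin

text \<open>
  Buyers are \<open>0, \<dots>, n - 1\<close> and items are \<open>0, \<dots>, m - 1\<close>, in order of arrival.  The graph is the list
  \<open>N\<close> of arriving items, where \<open>N ! j\<close> is the set of buyers interested in item \<open>j\<close>.  Values and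
  reports are lists of length \<open>n\<close>, so that \<open>b[i := x]\<close> is the profile in which buyer \<open>i\<close> reports \<open>x\<close>
  and the other buyers report as in \<open>b\<close>.
\<close>

definition profiles :: "nat \<Rightarrow> real list set" where
  "profiles n = {b. length b = n \<and> (\<forall>x\<in>set b. 0 \<le> x)}"

definition arrivals :: "nat \<Rightarrow> nat \<Rightarrow> nat set list set" where
  "arrivals n m = {N. length N = m \<and> (\<forall>S\<in>set N. S \<subseteq> {..<n})}"

definition edges :: "nat set list \<Rightarrow> (nat \<times> nat) set" where
  "edges N = {(i, j). j < length N \<and> i \<in> N ! j}"

definition is_matching :: "(nat \<times> nat) set \<Rightarrow> (nat \<times> nat) set \<Rightarrow> bool" where
  "is_matching E \<mu> \<longleftrightarrow> \<mu> \<subseteq> E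
     \<and> (\<forall>i j j'. (i, j) \<in> \<mu> \<longrightarrow> (i, j') \<in> \<mu> \<longrightarrow> j = j')
     \<and> (\<forall>i i' j. (i, j) \<in> \<mu> \<longrightarrow> (i', j) \<in> \<mu> \<longrightarrow> i = i')"

definition served :: "(nat \<times> nat) set \<Rightarrow> (nat \<times> nat) set \<Rightarrow> nat \<Rightarrow> bool" where
  "served E \<mu> i \<longleftrightarrow> (\<exists>j. (i, j) \<in> \<mu> \<and> (i, j) \<in> E)"

definition welfare :: "real list \<Rightarrow> nat set list \<Rightarrow> (nat \<times> nat) set \<Rightarrow> real" where
  "welfare v N \<mu> = (\<Sum>i<length v. v ! i * of_bool (served (edges N) \<mu> i))"

definition opt :: "real list \<Rightarrow> nat set list \<Rightarrow> real" where
  "opt v N = Max {welfare v N \<mu> | \<mu>. is_matching (edges N) \<mu>}"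

text \<open>
  A deterministic mechanism.  \<open>alloc D b P\<close> is the decision on the last item of the nonempty prefix
  \<open>P\<close> of the arrival sequence, so it cannot depend on later items; \<open>None\<close> leaves the item unassigned.
  \<open>pay D b N i\<close> is the payment of buyer \<open>i\<close> on the complete sequence \<open>N\<close>.
\<close>

record mechanism =
  alloc :: "real list \<Rightarrow> nat set list \<Rightarrow> nat option"
  pay :: "real list \<Rightarrow> nat set list \<Rightarrow> nat \<Rightarrow> real"

definition outcome :: "mechanism \<Rightarrow> real list \<Rightarrow> nat set list \<Rightarrow> (nat \<times> nat) set" where
  "outcome D b N = {(i, j). j < length N \<and> alloc D b (take (Suc j) N) = Some i}"

definition feasible :: "nat \<Rightarrow> nat \<Rightarrow> mechanism \<Rightarrow> bool" where
  "feasible n m D \<longleftrightarrow> (\<forall>b\<in>profiles n. \<forall>N\<in>arrivals n m.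
     is_matching (edges N) (outcome D b N) \<and> (\<forall>i<n. 0 \<le> pay D b N i))"

text \<open>\<open>utility D x b N i\<close> is the utility of buyer \<open>i\<close> with true value \<open>x\<close> when the reports are \<open>b\<close>.\<close>

definition utility :: "mechanism \<Rightarrow> real \<Rightarrow> real list \<Rightarrow> nat set list \<Rightarrow> nat \<Rightarrow> real" where
  "utility D x b N i = x * of_bool (served (edges N) (outcome D b N) i) - pay D b N i"

definition truthful :: "nat \<Rightarrow> nat \<Rightarrow> mechanism \<Rightarrow> bool" where
  "truthful n m D \<longleftrightarrow> (\<forall>N\<in>arrivals n m. \<forall>b\<in>profiles n. \<forall>i<n. \<forall>x\<ge>0.
     utility D x b N i \<le> utility D x (b[i := x]) N i)"

definition individually_rational :: "nat \<Rightarrow> nat \<Rightarrow> mechanism \<Rightarrow> bool" where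
  "individually_rational n m D \<longleftrightarrow> (\<forall>N\<in>arrivals n m. \<forall>b\<in>profiles n. \<forall>i<n.
     0 \<le> utility D (b ! i) b N i)"

definition prompt :: "nat \<Rightarrow> nat \<Rightarrow> mechanism \<Rightarrow> bool" where
  "prompt n m D \<longleftrightarrow> (\<forall>b\<in>profiles n. \<forall>N\<in>arrivals n m. \<forall>N'\<in>arrivals n m. \<forall>i j.
     (i, j) \<in> outcome D b N \<longrightarrow> take (Suc j) N = take (Suc j) N' \<longrightarrow> pay D b N i = pay D b N' i)"

text \<open>
  A randomized mechanism is a probability measure on deterministic ones, on any \<open>\<sigma>\<close>-algebra for
  which every outcome is a random matching; the elements of \<open>space M\<close> are the realizations.
\<close>

definition randomized_mechanism :: "nat \<Rightarrow> nat \<Rightarrow> mechanism measure \<Rightarrow> bool" where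
  "randomized_mechanism n m M \<longleftrightarrow> prob_space M
     \<and> (\<forall>D\<in>space M. feasible n m D)
     \<and> (\<forall>b\<in>profiles n. \<forall>N\<in>arrivals n m. (\<lambda>D. outcome D b N) \<in> M \<rightarrow>\<^sub>M count_space UNIV)"

definition prompt_truthful_mechanism :: "nat \<Rightarrow> nat \<Rightarrow> mechanism measure \<Rightarrow> bool" where
  "prompt_truthful_mechanism n m M \<longleftrightarrow> randomized_mechanism n m M
     \<and> (\<forall>D\<in>space M. truthful n m D \<and> individually_rational n m D \<and> prompt n m D)"

definition competitive :: "nat \<Rightarrow> nat \<Rightarrow> mechanism measure \<Rightarrow> real \<Rightarrow> bool" where
  "competitive n m M \<alpha> \<longleftrightarrow> 1 \<le> \<alpha> \<and> (\<forall>v\<in>profiles n. \<forall>N\<in>arrivals n m.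
     opt v N \<le> \<alpha> * (\<integral>D. welfare v N (outcome D v N) \<partial>M))"

text \<open>In \<^typ>\<open>ereal\<close>, the infimum of the empty set is \<open>\<infinity>\<close>.\<close>

definition competitive_ratio :: "nat \<Rightarrow> nat \<Rightarrow> mechanism measure \<Rightarrow> ereal" where
  "competitive_ratio n m M = Inf {ereal \<alpha> | \<alpha>. competitive n m M \<alpha>}"

end

theory Submission
  imports Defs
begin

text \<open>
  Fix the graph and the other reports.  Truthfulness and promptness together mean that once some report
  of buyer \<open>i\<close> would win her an item at a price \<open>p\<close>, this price is frozen: reports above \<open>p\<close> must
  already have won, and reports below \<open>p\<close> never win.  So with too few items so far, pricing many buyers
  low is impossible, while pricing many buyers high forfeits them for the rest of the sequence.

  The hard instances offer \<open>C ^ l\<close> items wanted by all of \<open>R = C ^ k\<close> buyers, for an unknown \<open>l \<le> k\<close>.  The values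
  are independent, and equal to \<open>(2 / C) ^ s\<close> on level \<open>s\<close>, where levels up to \<open>s\<close> have probability
  \<open>C ^ s / R\<close>, so that the expected optimum is at least \<open>2 ^ l / 2\<close>.  A buyer whose price lies on
  level \<open>\<sigma>\<close> is worth at most \<open>2 ^ (\<sigma> + 1) / R\<close>.  Buyers with \<open>\<sigma> \<le> l + 1\<close> contribute a geometric series
  over \<open>l\<close>; those with \<open>\<sigma> \<ge> l + 2\<close> must be served by then with probability at
  least \<open>C ^ (\<sigma> - 1) / R\<close>, so the
  limit of \<open>C ^ l\<close> items bounds their contribution by \<open>8 * 2 ^ l / C\<close>.  For \<open>k < C\<close> the expected welfares,
  scaled by \<open>2 ^ -l\<close> and summed over \<open>l \<le> k\<close>, are hence at most \<open>16\<close>, against at least \<open>(k + 1) / 2\<close> for the optima.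
  The choice \<open>C = k + 1\<close> and \<open>k = \<lfloor>ln \<nu> / ln (ln \<nu>)\<rfloor>\<close> gives \<open>R \<le> \<nu>\<close>.
\<close>

section \<open>Independent uniform draws\<close>

text \<open>The sample space. Expectations over it appear as unnormalised sums, hence the factors
  \<open>card (draws R r)\<close>.\<close>

definition draws :: "nat \<Rightarrow> nat \<Rightarrow> nat list set" where
  "draws R r = {a. set a \<subseteq> {..<R} \<and> length a = r}"

lemma card_draws_pos: "0 < R \<Longrightarrow> 0 < card (draws R r)"
  unfolding draws_def by (subst card_lists_length_eq) auto

lemma draws_nth_less: "a \<in> draws R r \<Longrightarrow> i < r \<Longrightarrow> a ! i < R"
  by (force simp: draws_def)

lemma draws_update: "a \<in> draws R r \<Longrightarrow> x < R \<Longrightarrow> a[i := x] \<in> draws R r"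
  using set_update_subset_insert[of a i x] by (auto simp: draws_def)

text \<open>Exchanging \<open>a ! i\<close> with \<open>x\<close> is an involution on the pairs
  \<open>(a, x)\<close>. The identity allows averaging over one buyer's value with all others
  fixed.\<close>

lemma sum_draws_resample:
  fixes f :: "nat list \<Rightarrow> real"
  assumes "i < r"
  shows "(\<Sum>a\<in>draws R r. \<Sum>x<R. f (a[i := x])) = real R * (\<Sum>a\<in>draws R r. f a)"
proof -
  have "(\<Sum>a\<in>draws R r. \<Sum>x<R. f (a[i := x]))
      = (\<Sum>(a, x)\<in>draws R r \<times> {..<R}. f (a[i := x]))"
    by (simp add: sum.cartesian_product)
  also have "\<dots> = (\<Sum>(a, x)\<in>draws R r \<times> {..<R}. f a)"
    by (rule sum.reindex_bij_witness[where i = "\<lambda>(a, x). (a[i := x], a ! i)"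
          and j = "\<lambda>(a, x). (a[i := x], a ! i)"])
      (use assms in \<open>auto simp: draws_update draws_nth_less, auto simp: draws_def\<close>)
  also have "\<dots> = (\<Sum>a\<in>draws R r. \<Sum>x<R. f a)"
    by (simp only: sum.cartesian_product)
  also have "\<dots> = real R * (\<Sum>a\<in>draws R r. f a)"
    by (simp add: sum_distrib_left)
  finally show ?thesis .
qed

lemma sum_draws_less:
  assumes "i < r" "t \<le> R"
  shows "real R * (\<Sum>a\<in>draws R r. of_bool (a ! i < t)) = real (card (draws R r)) * real t"
proof -
  have "(\<Sum>a\<in>draws R r. \<Sum>x<R. (of_bool (a[i := x] ! i < t) :: real))
      = (\<Sum>a\<in>draws R r. real t)"
  proof (rule sum.cong)
    fix a assume "a \<in> draws R r"
    then have "(\<Sum>x<R. (of_bool (a[i := x] ! i < t) :: real)) = (\<Sum>x<R. of_bool (x < t))"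
      using assms by (simp add: draws_def)
    also have "\<dots> = real (card ({..<R} \<inter> {x. x < t}))"
      by simp
    also have "{..<R} \<inter> {x. x < t} = {..<t}"
      using assms by auto
    finally show "(\<Sum>x<R. (of_bool (a[i := x] ! i < t) :: real)) = real t"
      by simp
  qed simp
  then show ?thesis
    using sum_draws_resample[OF assms(1), where R = R and f = "\<lambda>a. of_bool (a ! i < t)"] by simp
qed

lemma sum_draws_less_less:
  assumes "i < r" "j < r" "i \<noteq> j" "t \<le> R"
  shows "real R * real R * (\<Sum>a\<in>draws R r. of_bool (a ! i < t) * of_bool (a ! j < t))
    = real (card (draws R r)) * real t * real t"
proof -
  let ?f = "\<lambda>a. of_bool (a ! i < t) * of_bool (a ! j < t) :: real"
  have "real R * (\<Sum>a\<in>draws R r. ?f a) = (\<Sum>a\<in>draws R r. \<Sum>x<R. ?f (a[i := x]))"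
    using sum_draws_resample[OF assms(1), where R = R and f = ?f] by simp
  also have "\<dots> = (\<Sum>a\<in>draws R r. of_bool (a ! j < t) * real t)"
  proof (rule sum.cong)
    fix a assume "a \<in> draws R r"
    then have "(\<Sum>x<R. ?f (a[i := x])) = (\<Sum>x<R. of_bool (x < t) * of_bool (a ! j < t))"
      using assms by (simp add: draws_def)
    also have "\<dots> = (\<Sum>x<R. of_bool (x < t)) * of_bool (a ! j < t)"
      by (simp only: sum_distrib_right)
    also have "(\<Sum>x<R. (of_bool (x < t) :: real)) = real (card ({..<R} \<inter> {x. x < t}))"
      by simp
    also have "{..<R} \<inter> {x. x < t} = {..<t}"
      using assms by auto
    finally show "(\<Sum>x<R. ?f (a[i := x])) = of_bool (a ! j < t) * real t"
      by simp
  qed simp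
  also have "\<dots> = (\<Sum>a\<in>draws R r. of_bool (a ! j < t)) * real t"
    by (simp only: sum_distrib_right)
  finally show ?thesis
    using sum_draws_less[OF assms(2,4)] by (simp add: algebra_simps)
qed

text \<open>Second moment method: \<open>min t X \<ge> X - X\<^sup>2 / (4 * t)\<close>, where \<open>X\<close> has mean \<open>t\<close> and variance at
  most \<open>t\<close>.\<close>

lemma sum_draws_min_ge:
  assumes "0 < t" "t \<le> R"
  shows "real (card (draws R R)) * real t / 2
    \<le> (\<Sum>a\<in>draws R R. min (real t) (\<Sum>i<R. of_bool (a ! i < t)))"
proof -
  let ?A = "draws R R" and ?X = "\<lambda>a. \<Sum>i<R. of_bool (a ! i < t) :: real"
  have R: "0 < real R" and t: "0 < real t" using assms by auto
  have 1: "(\<Sum>a\<in>?A. of_bool (a ! i < t)) = real (card ?A) * real t / real R" if "i < R" for i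
    using sum_draws_less[OF that assms(2)] R by (simp add: field_simps)
  have EX: "(\<Sum>a\<in>?A. ?X a) = real (card ?A) * real t"
    using R by (subst sum.swap) (simp add: 1 del: sum_of_bool_eq)
  \<comment> \<open>Off the diagonal, independence gives the product of the means; on it, the square
    of an indicator is the indicator.\<close>
  have 2: "(\<Sum>a\<in>?A. of_bool (a ! i < t) * of_bool (a ! j < t))
      \<le> real (card ?A) * real t * real t / (real R * real R)
        + of_bool (i = j) * (real (card ?A) * real t / real R)" if "i < R" "j < R" for i j
  proof (cases "i = j")
    case True
    have "(\<Sum>a\<in>?A. of_bool (a ! i < t) * of_bool (a ! j < t)) = (\<Sum>a\<in>?A. (of_bool (a ! i < t) :: real))"
      using True by (intro sum.cong) auto
    then show ?thesis
      using 1[OF that(1)] True by simp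
  next
    case False
    then show ?thesis
      using sum_draws_less_less[OF that False assms(2)] R by (simp add: field_simps)
  qed
  have "(\<Sum>a\<in>?A. (?X a)\<^sup>2)
      = (\<Sum>a\<in>?A. \<Sum>i<R. \<Sum>j<R. of_bool (a ! i < t) * of_bool (a ! j < t))"
    by (simp only: power2_eq_square sum_product)
  also have "\<dots> = (\<Sum>i<R. \<Sum>j<R. \<Sum>a\<in>?A. of_bool (a ! i < t) * of_bool (a ! j < t))"
    by (subst sum.swap, subst sum.swap[of _ _ ?A]) (rule refl)
  also have "\<dots> \<le> (\<Sum>i<R. \<Sum>j<R. real (card ?A) * real t * real t / (real R * real R)
        + of_bool (i = j) * (real (card ?A) * real t / real R))"
    by (intro sum_mono 2) auto
  also have "\<dots> = (\<Sum>i<R. real (card ?A) * real t * real t / real R + real (card ?A) * real t / real R)"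
  proof (rule sum.cong)
    fix i assume "i \<in> {..<R}"
    have "(\<Sum>j<R. of_bool (i = j) * (real (card ?A) * real t / real R))
        = (\<Sum>j<R. if i = j then real (card ?A) * real t / real R else 0)"
      by (intro sum.cong) auto
    also have "\<dots> = real (card ?A) * real t / real R"
      using \<open>i \<in> {..<R}\<close> by (subst sum.delta') auto
    finally show "(\<Sum>j<R. real (card ?A) * real t * real t / (real R * real R)
        + of_bool (i = j) * (real (card ?A) * real t / real R))
      = real (card ?A) * real t * real t / real R + real (card ?A) * real t / real R"
      using R by (simp add: sum.distrib del: sum_of_bool_mult_eq)
  qed simp
  also have "\<dots> = real (card ?A) * (real t * real t + real t)"
    using R by (simp add: field_simps)
  \<comment> \<open>A positive integer \<open>t\<close> satisfies
    \<open>t \<le> t * t\<close>.\<close>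
  also have "\<dots> \<le> real (card ?A) * (2 * real t * real t)"
    using assms by (intro mult_left_mono) (auto simp: mult_le_cancel_left1)
  finally have EX2: "(\<Sum>a\<in>?A. (?X a)\<^sup>2) \<le> real (card ?A) * (2 * real t * real t)" .
  have "real (card ?A) * real t / 2
      = real (card ?A) * real t - (real (card ?A) * (2 * real t * real t)) / (4 * real t)"
    using t by (simp add: field_simps)
  also have "\<dots> \<le> (\<Sum>a\<in>?A. ?X a) - (\<Sum>a\<in>?A. (?X a)\<^sup>2) / (4 * real t)"
    unfolding EX using EX2 t by (intro diff_left_mono divide_right_mono) auto
  also have "\<dots> = (\<Sum>a\<in>?A. ?X a - (?X a)\<^sup>2 / (4 * real t))"
    by (simp only: sum_subtractf sum_divide_distrib)
  also have "\<dots> \<le> (\<Sum>a\<in>?A. min (real t) (?X a))"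
  proof (rule sum_mono)
    fix a
    have "0 \<le> (?X a - 2 * real t)\<^sup>2" by simp
    then have "?X a - (?X a)\<^sup>2 / (4 * real t) \<le> real t"
      using t by (simp add: field_simps power2_eq_square del: sum_of_bool_eq)
    moreover have "?X a - (?X a)\<^sup>2 / (4 * real t) \<le> ?X a"
      using t by (simp del: sum_of_bool_eq)
    ultimately show "?X a - (?X a)\<^sup>2 / (4 * real t) \<le> min (real t) (?X a)"
      by simp
  qed
  finally show ?thesis .
qed

section \<open>Values on geometric levels\<close>

definition wt :: "nat \<Rightarrow> nat \<Rightarrow> real" where
  "wt C s = (2 / real C) ^ s"

text \<open>For \<open>3 \<le> C\<close>, \<open>s \<le> k\<close> and \<open>x\<close> uniform
  below \<open>C ^ k\<close>, level at most \<open>s\<close> means \<open>x < C ^ s\<close>, which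
  has probability \<open>C ^ s / C ^ k\<close>.\<close>

definition lev :: "nat \<Rightarrow> nat \<Rightarrow> nat" where
  "lev C x = (LEAST s. x < C ^ s)"

lemma wt_nonneg: "0 \<le> wt C s"
  by (simp add: wt_def)

lemma wt_antimono: "3 \<le> C \<Longrightarrow> s \<le> s' \<Longrightarrow> wt C s' \<le> wt C s"
  unfolding wt_def by (rule power_decreasing) auto

lemma wt_strict_antimono: "3 \<le> C \<Longrightarrow> s < s' \<Longrightarrow> wt C s' < wt C s"
  unfolding wt_def by (rule power_strict_decreasing) auto

lemma power_mult_wt: "3 \<le> C \<Longrightarrow> real C ^ s * wt C s = 2 ^ s"
  by (simp add: wt_def flip: power_mult_distrib)

lemma less_power_lev:
  assumes "3 \<le> C" shows "x < C ^ lev C x"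
  unfolding lev_def by (rule LeastI[of _ x], rule power_gt_expt) (use assms in auto)

lemma lev_le: "x < C ^ s \<Longrightarrow> lev C x \<le> s"
  unfolding lev_def by (rule Least_le)

text \<open>Charge \<open>x\<close> to every \<open>s \<le> \<sigma>\<close> with
  \<open>x < C ^ s\<close>, its own level among them. At most \<open>C ^ s\<close> draws are charged
  to \<open>s\<close>, for a total of at most \<open>2 ^ s\<close>, and these sum
  geometrically.\<close>

lemma sum_wt_le:
  assumes "3 \<le> C"
  shows "(\<Sum>x<R. of_bool (lev C x \<le> \<sigma>) * wt C (lev C x)) \<le> 2 ^ (\<sigma> + 1)"
proof -
  have "(\<Sum>x<R. of_bool (lev C x \<le> \<sigma>) * wt C (lev C x))
      \<le> (\<Sum>x<R. \<Sum>s\<le>\<sigma>. of_bool (x < C ^ s) * wt C s)"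
  proof (rule sum_mono)
    fix x
    show "of_bool (lev C x \<le> \<sigma>) * wt C (lev C x) \<le> (\<Sum>s\<le>\<sigma>. of_bool (x < C ^ s) * wt C s)"
    proof (cases "lev C x \<le> \<sigma>")
      case True
      then show ?thesis
        using member_le_sum[of "lev C x" "{..\<sigma>}" "\<lambda>s. of_bool (x < C ^ s) * wt C s"]
          less_power_lev[OF assms, of x] by (simp add: wt_nonneg del: sum_of_bool_mult_eq)
    qed (simp add: sum_nonneg wt_nonneg del: sum_of_bool_mult_eq)
  qed
  also have "\<dots> = (\<Sum>s\<le>\<sigma>. (\<Sum>x<R. of_bool (x < C ^ s)) * wt C s)"
    by (subst sum.swap) (simp only: sum_distrib_right)
  also have "\<dots> \<le> (\<Sum>s\<le>\<sigma>. real (C ^ s) * wt C s)"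
  proof (intro sum_mono mult_right_mono wt_nonneg)
    fix s
    have "card ({..<R} \<inter> {x. x < C ^ s}) \<le> card {..<C ^ s}"
      by (intro card_mono) auto
    then show "(\<Sum>x<R. of_bool (x < C ^ s)) \<le> real (C ^ s)"
      by (simp del: of_nat_power)
  qed
  also have "\<dots> = (\<Sum>s\<le>\<sigma>. 2 ^ s)"
    using assms by (simp add: power_mult_wt)
  also have "\<dots> \<le> 2 ^ (\<sigma> + 1)"
    by (induction \<sigma>) auto
  finally show ?thesis .
qed

text \<open>All draws below \<open>C ^ (\<sigma> - 1)\<close> have level at most
  \<open>\<sigma> - 1\<close>. At \<open>\<sigma> = 0\<close> truncated subtraction would make the
  left side 1 against an empty count.\<close>

lemma sum_lev_less_ge:
  assumes "0 < C" "\<sigma> \<le> k" "0 < \<sigma>"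
  shows "real C ^ (\<sigma> - 1) \<le> (\<Sum>x<C ^ k. of_bool (lev C x < \<sigma>))"
proof -
  have "{..<C ^ (\<sigma> - 1)} \<subseteq> {..<C ^ k} \<inter> {x. lev C x < \<sigma>}"
  proof
    fix x assume "x \<in> {..<C ^ (\<sigma> - 1)}"
    then have "x < C ^ (\<sigma> - 1)" by simp
    moreover have "C ^ (\<sigma> - 1) \<le> C ^ k"
      using assms by (intro power_increasing) auto
    ultimately show "x \<in> {..<C ^ k} \<inter> {x. lev C x < \<sigma>}"
      using lev_le[of x C "\<sigma> - 1"] assms by auto
  qed
  then have "card {..<C ^ (\<sigma> - 1)} \<le> card ({..<C ^ k} \<inter> {x. lev C x < \<sigma>})"
    by (intro card_mono) auto
  then show ?thesis
    by (simp flip: of_nat_power)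
qed

text \<open>A price level beyond \<open>l + 1\<close> is charged to forced purchases: with
  \<open>\<sigma> = l + 2 + d\<close>, the factor \<open>2 ^ d\<close> is at most
  \<open>C ^ d\<close>, which is \<open>C ^ (\<sigma> - 1) / C ^ (l + 1)\<close>.\<close>

lemma two_power_le_split:
  assumes "3 \<le> C" "\<sigma> \<le> k"
  shows "(2::real) ^ (\<sigma> + 1) \<le> of_bool (\<sigma> \<le> l + 1) * 2 ^ (\<sigma> + 1)
    + 8 * 2 ^ l / real C ^ (l + 1) * (\<Sum>x<C ^ k. of_bool (lev C x < \<sigma>))"
proof (cases "\<sigma> \<le> l + 1")
  case True
  then show ?thesis by simp
next
  case False
  then obtain d where d: "\<sigma> = l + 2 + d"
    by (metis Suc_eq_plus1 add_2_eq_Suc' less_iff_Suc_add not_le add_Suc add_Suc_right)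
  have C: "2 \<le> real C" using assms by simp
  have "(2::real) ^ (\<sigma> + 1) = 8 * 2 ^ l * 2 ^ d"
    by (simp add: d power_add)
  also have "\<dots> \<le> 8 * 2 ^ l * real C ^ d"
    using C by (intro mult_left_mono power_mono) auto
  also have "\<dots> = 8 * 2 ^ l / real C ^ (l + 1) * real C ^ (\<sigma> - 1)"
    using C by (simp add: d power_add)
  also have "\<dots> \<le> 8 * 2 ^ l / real C ^ (l + 1) * (\<Sum>x<C ^ k. of_bool (lev C x < \<sigma>))"
    using assms d by (intro mult_left_mono sum_lev_less_ge) auto
  finally show ?thesis using False by simp
qed

text \<open>The nonzero terms start at stage \<open>\<sigma> - 1\<close> with at most 4 and halve
  from then on.\<close>

lemma sum_geometric_tail_le:
  "(\<Sum>l\<le>k. of_bool (\<sigma> \<le> l + 1) * 2 ^ (\<sigma> + 1) / (2::real) ^ l) \<le> 8"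
proof -
  \<comment> \<open>The remainder of a halving series equals its last term, so subtracting that term
    makes the induction close.\<close>
  have "(\<Sum>l\<le>k. of_bool (\<sigma> \<le> l + 1) * 2 ^ (\<sigma> + 1) / (2::real) ^ l)
      \<le> 8 - of_bool (\<sigma> \<le> k + 1) * 2 ^ (\<sigma> + 1) / 2 ^ k"
  proof (induction k)
    case 0
    have "\<sigma> = 0 \<or> \<sigma> = 1 \<or> \<sigma> > 1" by auto
    then show ?case by auto
  next
    case (Suc k)
    consider "\<sigma> \<le> k + 1" | "\<sigma> = k + 2" | "\<sigma> > k + 2" by linarith
    then show ?case
    proof cases
      case 1
      have "(2::real) ^ (\<sigma> + 1) / 2 ^ k = 2 * (2 ^ (\<sigma> + 1) / 2 ^ Suc k)"
        by simp
      then show ?thesis using Suc 1 by (simp del: power_Suc)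
    next
      case 2
      then show ?thesis using Suc by (simp add: field_simps)
    next
      case 3
      then show ?thesis using Suc by simp
    qed
  qed
  also have "\<dots> \<le> 8" by simp
  finally show ?thesis .
qed

section \<open>Amortised welfare bound over the stages\<close>

text \<open>Mechanism-free form of one stage: \<open>S\<close> stands for served, \<open>H\<close>
  for priced, \<open>\<sigma>\<close> for the price level. As \<open>H a i\<close> and
  \<open>\<sigma> a i\<close> ignore \<open>a ! i\<close>, that coordinate can be redrawn. Once
  priced, levels below \<open>\<sigma>\<close> must buy, while level \<open>\<sigma>\<close> itself
  may.\<close>

lemma stage_welfare_le:
  fixes S H :: "nat list \<Rightarrow> nat \<Rightarrow> bool" and \<sigma> :: "nat list \<Rightarrow> nat \<Rightarrow> nat"
  assumes C: "3 \<le> C" and R: "R = C ^ k"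
    and H_update: "\<And>a i x. a \<in> draws R R \<Longrightarrow> i < R \<Longrightarrow> x < R \<Longrightarrow> H (a[i := x]) i = H a i"
    and \<sigma>_update: "\<And>a i x. a \<in> draws R R \<Longrightarrow> i < R \<Longrightarrow> x < R \<Longrightarrow> \<sigma> (a[i := x]) i = \<sigma> a i"
    and \<sigma>_le: "\<And>a i. \<sigma> a i \<le> k"
    and SH: "\<And>a i. a \<in> draws R R \<Longrightarrow> i < R \<Longrightarrow> S a i \<Longrightarrow> H a i \<and> lev C (a ! i) \<le> \<sigma> a i"
    and HS: "\<And>a i. a \<in> draws R R \<Longrightarrow> i < R \<Longrightarrow> H a i \<Longrightarrow> lev C (a ! i) < \<sigma> a i \<Longrightarrow> S a i"
    and cap: "\<And>a. a \<in> draws R R \<Longrightarrow> card {i. i < R \<and> S a i} \<le> C ^ l"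
  shows "(\<Sum>a\<in>draws R R. \<Sum>i<R. wt C (lev C (a ! i)) * of_bool (S a i)) / 2 ^ l
    \<le> (\<Sum>i<R. \<Sum>a\<in>draws R R. of_bool (\<sigma> a i \<le> l + 1) * 2 ^ (\<sigma> a i + 1) / 2 ^ l) / real R
      + 8 / real C * real (card (draws R R))"
proof -
  let ?A = "draws R R" and ?K = "8 * 2 ^ l / real C ^ (l + 1)"
  have R0: "0 < real R" using R C by simp
  have buyer: "(\<Sum>a\<in>?A. wt C (lev C (a ! i)) * of_bool (S a i))
      \<le> (\<Sum>a\<in>?A. of_bool (\<sigma> a i \<le> l + 1) * 2 ^ (\<sigma> a i + 1)) / real R
        + ?K * (\<Sum>a\<in>?A. of_bool (S a i))" if i: "i < R" for i
  proof -
    \<comment> \<open>\<open>?f\<close> bounds the value obtained from above, \<open>?g\<close> the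
      indicator of service from below.\<close>
    let ?f = "\<lambda>a. of_bool (H a i) * (of_bool (lev C (a ! i) \<le> \<sigma> a i) * wt C (lev C (a ! i)))"
    let ?g = "\<lambda>a. of_bool (H a i) * of_bool (lev C (a ! i) < \<sigma> a i) :: real"
    have len: "a \<in> ?A \<Longrightarrow> i < length a" for a
      using i by (simp add: draws_def)
    have "real R * (\<Sum>a\<in>?A. wt C (lev C (a ! i)) * of_bool (S a i)) \<le> real R * (\<Sum>a\<in>?A. ?f a)"
    proof (intro mult_left_mono sum_mono)
      fix a assume "a \<in> ?A"
      then show "wt C (lev C (a ! i)) * of_bool (S a i) \<le> ?f a"
        using SH[OF _ i, of a] by (cases "S a i") (auto simp: wt_nonneg)
    qed simp
    also have "\<dots> = (\<Sum>a\<in>?A. \<Sum>x<R. ?f (a[i := x]))"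
      using sum_draws_resample[OF i, where R = R and f = ?f] by simp
    also have "\<dots> = (\<Sum>a\<in>?A. of_bool (H a i) *
        (\<Sum>x<R. of_bool (lev C x \<le> \<sigma> a i) * wt C (lev C x)))"
      unfolding sum_distrib_left
      by (intro sum.cong refl) (simp add: H_update[OF _ i] \<sigma>_update[OF _ i] len)
    also have "\<dots> \<le> (\<Sum>a\<in>?A. of_bool (H a i) * 2 ^ (\<sigma> a i + 1))"
      by (intro sum_mono mult_left_mono sum_wt_le C) simp
    also have "\<dots> \<le> (\<Sum>a\<in>?A. of_bool (\<sigma> a i \<le> l + 1) * 2 ^ (\<sigma> a i + 1)
        + ?K * (of_bool (H a i) * (\<Sum>x<R. of_bool (lev C x < \<sigma> a i))))"
    proof (rule sum_mono)
      fix a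
      show "of_bool (H a i) * 2 ^ (\<sigma> a i + 1) \<le> of_bool (\<sigma> a i \<le> l + 1) * 2 ^ (\<sigma> a i + 1)
        + ?K * (of_bool (H a i) * (\<Sum>x<R. of_bool (lev C x < \<sigma> a i)))"
        using two_power_le_split[OF C \<sigma>_le, of a i l] R
        by (cases "H a i") (simp_all del: sum_of_bool_eq power_Suc)
    qed
    also have "\<dots> = (\<Sum>a\<in>?A. of_bool (\<sigma> a i \<le> l + 1) * 2 ^ (\<sigma> a i + 1))
        + ?K * (\<Sum>a\<in>?A. \<Sum>x<R. ?g (a[i := x]))"
    proof -
      have "(\<Sum>a\<in>?A. of_bool (H a i) * (\<Sum>x<R. of_bool (lev C x < \<sigma> a i)))
          = (\<Sum>a\<in>?A. \<Sum>x<R. ?g (a[i := x]))"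
        unfolding sum_distrib_left
        by (intro sum.cong refl) (simp add: H_update[OF _ i] \<sigma>_update[OF _ i] len)
      then show ?thesis
        by (simp only: sum.distrib sum_distrib_left[symmetric])
    qed
    \<comment> \<open>Undoing the resampling turns the count of forced levels into buyers actually
      served, which the supply limits.\<close>
    also have "\<dots> = (\<Sum>a\<in>?A. of_bool (\<sigma> a i \<le> l + 1) * 2 ^ (\<sigma> a i + 1))
        + ?K * (real R * (\<Sum>a\<in>?A. ?g a))"
      using sum_draws_resample[OF i, where R = R and f = ?g] by (simp only:)
    also have "\<dots> \<le> (\<Sum>a\<in>?A. of_bool (\<sigma> a i \<le> l + 1) * 2 ^ (\<sigma> a i + 1))
        + ?K * (real R * (\<Sum>a\<in>?A. of_bool (S a i)))"
    proof (intro add_left_mono mult_left_mono sum_mono)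
      fix a assume "a \<in> ?A"
      then show "?g a \<le> of_bool (S a i)"
        using HS[OF _ i, of a] by auto
    qed auto
    finally show ?thesis
      using R0 by (simp add: field_simps del: sum_of_bool_eq sum_of_bool_mult_eq sum_mult_of_bool_eq)
  qed
  have cap': "(\<Sum>i<R. of_bool (S a i)) \<le> real C ^ l" if "a \<in> ?A" for a
  proof -
    have "{..<R} \<inter> {i. S a i} = {i. i < R \<and> S a i}" by auto
    then show ?thesis
      using cap[OF that] by (simp flip: of_nat_power)
  qed
  have "(\<Sum>a\<in>?A. \<Sum>i<R. wt C (lev C (a ! i)) * of_bool (S a i))
      = (\<Sum>i<R. \<Sum>a\<in>?A. wt C (lev C (a ! i)) * of_bool (S a i))"
    by (rule sum.swap)
  also have "\<dots> \<le> (\<Sum>i<R. (\<Sum>a\<in>?A. of_bool (\<sigma> a i \<le> l + 1) * 2 ^ (\<sigma> a i + 1)) / real R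
        + ?K * (\<Sum>a\<in>?A. of_bool (S a i)))"
    by (intro sum_mono buyer) simp
  also have "\<dots> = (\<Sum>i<R. \<Sum>a\<in>?A. of_bool (\<sigma> a i \<le> l + 1) * 2 ^ (\<sigma> a i + 1)) / real R
        + ?K * (\<Sum>a\<in>?A. \<Sum>i<R. of_bool (S a i))"
  proof -
    have "(\<Sum>a\<in>?A. \<Sum>i<R. (of_bool (S a i) :: real)) = (\<Sum>i<R. \<Sum>a\<in>?A. of_bool (S a i))"
      by (rule sum.swap)
    then show ?thesis
      by (simp only: sum.distrib sum_distrib_left sum_divide_distrib)
  qed
  also have "\<dots> \<le> (\<Sum>i<R. \<Sum>a\<in>?A. of_bool (\<sigma> a i \<le> l + 1) * 2 ^ (\<sigma> a i + 1)) / real R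
        + ?K * (\<Sum>a\<in>?A. real C ^ l)"
    by (intro add_left_mono mult_left_mono sum_mono cap') auto
  \<comment> \<open>Supply \<open>C ^ l\<close> against \<open>C ^ (l + 1)\<close> in
    \<open>?K\<close> leaves the decisive factor \<open>1 / C\<close>.\<close>
  also have "?K * (\<Sum>a\<in>?A. real C ^ l) = 8 / real C * real (card ?A) * 2 ^ l"
    using C by (simp add: field_simps)
  finally show ?thesis
    by (simp add: field_simps sum_divide_distrib[symmetric]
          del: sum_of_bool_eq sum_of_bool_mult_eq sum_mult_of_bool_eq)
qed

text \<open>\<open>\<sigma>\<close> carries no stage index, since prices are frozen; hence each
  buyer contributes a single geometric series over \<open>l\<close>. The supply terms, one per
  stage, add up to \<open>(k + 1) * 8 / C\<close>, at most 8, per draw.\<close>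

lemma total_welfare_le:
  fixes S H :: "nat \<Rightarrow> nat list \<Rightarrow> nat \<Rightarrow> bool" and \<sigma> :: "nat list \<Rightarrow> nat \<Rightarrow> nat"
  assumes C: "3 \<le> C" "k + 1 \<le> C" and R: "R = C ^ k"
    and H_update: "\<And>l a i x. l \<le> k \<Longrightarrow> a \<in> draws R R \<Longrightarrow> i < R \<Longrightarrow> x < R \<Longrightarrow>
      H l (a[i := x]) i = H l a i"
    and \<sigma>_update: "\<And>a i x. a \<in> draws R R \<Longrightarrow> i < R \<Longrightarrow> x < R \<Longrightarrow> \<sigma> (a[i := x]) i = \<sigma> a i"
    and \<sigma>_le: "\<And>a i. \<sigma> a i \<le> k"
    and SH: "\<And>l a i. l \<le> k \<Longrightarrow> a \<in> draws R R \<Longrightarrow> i < R \<Longrightarrow> S l a i \<Longrightarrow>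
      H l a i \<and> lev C (a ! i) \<le> \<sigma> a i"
    and HS: "\<And>l a i. l \<le> k \<Longrightarrow> a \<in> draws R R \<Longrightarrow> i < R \<Longrightarrow> H l a i \<Longrightarrow>
      lev C (a ! i) < \<sigma> a i \<Longrightarrow> S l a i"
    and cap: "\<And>l a. l \<le> k \<Longrightarrow> a \<in> draws R R \<Longrightarrow> card {i. i < R \<and> S l a i} \<le> C ^ l"
  shows "(\<Sum>l\<le>k. (\<Sum>a\<in>draws R R. \<Sum>i<R. wt C (lev C (a ! i)) * of_bool (S l a i)) / 2 ^ l)
    \<le> 16 * real (card (draws R R))"
proof -
  let ?A = "draws R R"
  let ?T = "\<lambda>l i a. of_bool (\<sigma> a i \<le> l + 1) * 2 ^ (\<sigma> a i + 1) / (2::real) ^ l"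
  have R0: "0 < real R" using R C by simp
  have "(\<Sum>l\<le>k. (\<Sum>a\<in>?A. \<Sum>i<R. wt C (lev C (a ! i)) * of_bool (S l a i)) / 2 ^ l)
      \<le> (\<Sum>l\<le>k. (\<Sum>i<R. \<Sum>a\<in>?A. ?T l i a) / real R + 8 / real C * real (card ?A))"
  proof (rule sum_mono)
    fix l assume "l \<in> {..k}"
    then have l: "l \<le> k" by simp
    show "(\<Sum>a\<in>?A. \<Sum>i<R. wt C (lev C (a ! i)) * of_bool (S l a i)) / 2 ^ l
      \<le> (\<Sum>i<R. \<Sum>a\<in>?A. ?T l i a) / real R + 8 / real C * real (card ?A)"
      by (rule stage_welfare_le[OF C(1) R, where H = "H l"])
        (fact H_update[OF l] \<sigma>_update \<sigma>_le SH[OF l] HS[OF l] cap[OF l])+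
  qed
  also have "\<dots> = (\<Sum>i<R. \<Sum>a\<in>?A. \<Sum>l\<le>k. ?T l i a) / real R
      + (real k + 1) * (8 / real C * real (card ?A))"
  proof -
    have "(\<Sum>l\<le>k. \<Sum>i<R. \<Sum>a\<in>?A. ?T l i a) = (\<Sum>i<R. \<Sum>a\<in>?A. \<Sum>l\<le>k. ?T l i a)"
      by (subst sum.swap, subst sum.swap[of _ _ ?A]) (rule refl)
    moreover have "(\<Sum>l\<le>k. f l / r + c) = (\<Sum>l\<le>k. f l) / r + (real k + 1) * c"
      for f :: "nat \<Rightarrow> real" and r c
      by (simp add: sum.distrib sum_divide_distrib[symmetric] add.commute)
    ultimately show ?thesis by (simp only:)
  qed
  also have "\<dots> \<le> (\<Sum>i<R. \<Sum>a\<in>?A. 8) / real R + real C * (8 / real C * real (card ?A))"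
    using C(2) by (intro add_mono divide_right_mono sum_mono sum_geometric_tail_le mult_right_mono) auto
  also have "\<dots> = 16 * real (card ?A)"
    using R0 C by simp
  finally show ?thesis .
qed

section \<open>Truthful prompt mechanisms post a price to each buyer\<close>

lemma profiles_update: "b \<in> profiles n \<Longrightarrow> 0 \<le> x \<Longrightarrow> b[i := x] \<in> profiles n"
  using set_update_subset_insert[of b i x] by (auto simp: profiles_def)

lemma served_outcome_iff:
  assumes "feasible n m D" "b \<in> profiles n" "N \<in> arrivals n m"
  shows "served (edges N) (outcome D b N) i \<longleftrightarrow> (\<exists>j. (i, j) \<in> outcome D b N)"
  using assms unfolding feasible_def is_matching_def served_def by blast

text \<open>Otherwise a buyer truthfully making the dearer of the two winning reports would gain by
  switching to the other.\<close>

lemma served_pay_unique: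
  assumes "truthful n m D" "N \<in> arrivals n m" "b \<in> profiles n" "i < n" "0 \<le> x" "0 \<le> y"
    and "served (edges N) (outcome D (b[i := x]) N) i"
    and "served (edges N) (outcome D (b[i := y]) N) i"
  shows "pay D (b[i := x]) N i = pay D (b[i := y]) N i"
proof -
  have "utility D y (b[i := x]) N i \<le> utility D y (b[i := x, i := y]) N i"
    "utility D x (b[i := y]) N i \<le> utility D x (b[i := y, i := x]) N i"
    using assms unfolding truthful_def by (metis profiles_update)+
  then show ?thesis
    using assms by (simp add: utility_def)
qed

text \<open>If the report \<open>y\<close> lost, a buyer of value \<open>y\<close> would do better
  with the report in \<open>b\<close>, at a positive utility.\<close>

lemma served_above_price:
  assumes "feasible n m D" "truthful n m D" "N \<in> arrivals n m" "b \<in> profiles n" "i < n"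
    and "served (edges N) (outcome D b N) i" "pay D b N i < y"
  shows "served (edges N) (outcome D (b[i := y]) N) i"
proof (rule ccontr)
  assume *: "\<not> ?thesis"
  have "0 \<le> pay D b N i"
    using assms by (auto simp: feasible_def)
  then have y: "0 \<le> y" using assms by simp
  then have "utility D y b N i \<le> utility D y (b[i := y]) N i"
    using assms unfolding truthful_def by blast
  moreover have "0 \<le> pay D (b[i := y]) N i"
    using assms profiles_update[OF assms(4) y] by (auto simp: feasible_def)
  ultimately show False
    using * assms by (simp add: utility_def)
qed

lemma pay_le_report:
  assumes "individually_rational n m D" "N \<in> arrivals n m" "b \<in> profiles n" "i < n"
    and "served (edges N) (outcome D b N) i"
  shows "pay D b N i \<le> b ! i"
  using assms by (force simp: individually_rational_def utility_def)

text \<open>The first level worth at most \<open>p\<close> serves as \<open>\<sigma>\<close>, or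
  \<open>k\<close> if no level up to \<open>k\<close> qualifies. A tie with the price falls on
  \<open>\<sigma>\<close> itself, where truthfulness forces nothing.\<close>

lemma price_level_exists:
  assumes "3 \<le> C"
  shows "\<exists>\<sigma>\<le>k. (\<forall>s<\<sigma>. p < wt C s) \<and> (\<forall>s\<le>k. p \<le> wt C s \<longrightarrow> s \<le> \<sigma>)"
proof (cases "\<exists>s\<le>k. wt C s \<le> p")
  case True
  define \<sigma> where "\<sigma> = (LEAST s. wt C s \<le> p)"
  from True obtain s where s: "s \<le> k" "wt C s \<le> p" by blast
  have "\<sigma> \<le> k"
    unfolding \<sigma>_def using Least_le[of "\<lambda>s. wt C s \<le> p" s] s by simp
  moreover have "\<forall>s<\<sigma>. p < wt C s"
    unfolding \<sigma>_def using not_less_Least by force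
  moreover have "wt C \<sigma> \<le> p"
    unfolding \<sigma>_def by (rule LeastI[of _ s]) fact
  then have "s \<le> \<sigma>" if "p \<le> wt C s" for s
    using wt_strict_antimono[OF assms, of \<sigma> s] that by (cases "\<sigma> < s") auto
  ultimately show ?thesis by blast
next
  case False
  then have "p < wt C s" if "s \<le> k" for s
    using that not_le by blast
  then show ?thesis
    by (intro exI[of _ k]) auto
qed

section \<open>Identical items in unknown supply\<close>

text \<open>Padding with items nobody wants fixes the length at \<open>m\<close>, so the supply can
  stop at any \<open>t\<close> without notice.\<close>

definition stock :: "nat \<Rightarrow> nat \<Rightarrow> nat \<Rightarrow> nat set list" where
  "stock R m t = replicate t {..<R} @ replicate (m - t) {}"

definition profile :: "nat \<Rightarrow> nat \<Rightarrow> nat list \<Rightarrow> real list" where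
  "profile C n a = map (\<lambda>x. wt C (lev C x)) a @ replicate (n - length a) 0"

lemma stock_arrivals: "t \<le> m \<Longrightarrow> R \<le> n \<Longrightarrow> stock R m t \<in> arrivals n m"
  by (auto simp: stock_def arrivals_def)

lemma edges_stock:
  assumes "t \<le> m" shows "edges (stock R m t) = {..<R} \<times> {..<t}"
proof -
  have "stock R m t ! j = (if j < t then {..<R} else {})" if "j < m" for j
    using that by (auto simp: stock_def nth_append)
  moreover have "length (stock R m t) = m"
    using assms by (simp add: stock_def)
  ultimately show ?thesis
    using assms by (auto simp: edges_def split: if_splits)
qed

lemma take_stock: "j < t \<Longrightarrow> take (Suc j) (stock R m t) = replicate (Suc j) {..<R}"
  by (simp add: stock_def min_def)

lemma profile_profiles: "length a \<le> n \<Longrightarrow> profile C n a \<in> profiles n"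
  by (auto simp: profile_def profiles_def wt_nonneg)

lemma profile_nth: "i < length a \<Longrightarrow> profile C n a ! i = wt C (lev C (a ! i))"
  by (simp add: profile_def nth_append)

lemma profile_update:
  "i < length a \<Longrightarrow> profile C n (a[i := x]) = (profile C n a)[i := wt C (lev C x)]"
  by (simp add: profile_def list_update_append map_update)

lemma welfare_profile:
  assumes "length a = R" "R \<le> n"
  shows "welfare (profile C n a) N \<mu>
    = (\<Sum>i<R. wt C (lev C (a ! i)) * of_bool (served (edges N) \<mu> i))"
proof -
  have len: "length (profile C n a) = n"
    using assms by (simp add: profile_def)
  show ?thesis
    unfolding welfare_def len
  proof (rule sum.mono_neutral_cong_right)
    show "\<forall>i\<in>{..<n} - {..<R}. profile C n a ! i * of_bool (served (edges N) \<mu> i) = 0"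
      using assms by (auto simp: profile_def nth_append)
  qed (use assms in \<open>auto simp: profile_nth\<close>)
qed

text \<open>Each of the \<open>t\<close> wanted items accounts for at most one served buyer; the
  padding items have no edges.\<close>

lemma card_served_stock:
  assumes "feasible n m D" "b \<in> profiles n" "t \<le> m" "R \<le> n"
  shows "card {i. i < R \<and> served (edges (stock R m t)) (outcome D b (stock R m t)) i} \<le> t"
proof -
  let ?N = "stock R m t"
  let ?g = "\<lambda>j. the (alloc D b (take (Suc j) ?N))"
  have "{i. i < R \<and> served (edges ?N) (outcome D b ?N) i} \<subseteq> ?g ` {..<t}"
    using edges_stock[OF assms(3), of R] by (force simp: served_def outcome_def)
  then have "card {i. i < R \<and> served (edges ?N) (outcome D b ?N) i} \<le> card (?g ` {..<t})"
    by (intro card_mono) auto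
  also have "\<dots> \<le> t"
    using card_image_le[of "{..<t}" ?g] by simp
  finally show ?thesis .
qed

text \<open>Both sequences agree up to the item that serves \<open>i\<close>, so the online decision
  is the same, and promptness fixes the payment with it.\<close>

lemma served_stock_mono:
  assumes "feasible n m D" "prompt n m D" "b \<in> profiles n" "t \<le> t'" "t' \<le> m" "R \<le> n"
    and "served (edges (stock R m t)) (outcome D b (stock R m t)) i"
  shows "served (edges (stock R m t')) (outcome D b (stock R m t')) i"
    and "pay D b (stock R m t) i = pay D b (stock R m t') i"
proof -
  let ?N = "stock R m t" and ?N' = "stock R m t'"
  have N: "?N \<in> arrivals n m" "?N' \<in> arrivals n m"
    using assms by (auto intro: stock_arrivals)
  obtain j where j: "(i, j) \<in> outcome D b ?N" "(i, j) \<in> edges ?N"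
    using assms(7) by (auto simp: served_def)
  then have "j < t" using assms by (simp add: edges_stock)
  then have take: "take (Suc j) ?N = take (Suc j) ?N'"
    using assms by (simp add: take_stock)
  have "(i, j) \<in> outcome D b ?N'"
    using j(1) \<open>j < t\<close> assms(4,5) unfolding outcome_def take by (simp add: stock_def)
  then show "served (edges ?N') (outcome D b ?N') i"
    using served_outcome_iff[OF assms(1,3) N(2)] by blast
  show "pay D b ?N i = pay D b ?N' i"
    using assms(2,3) N j(1) take unfolding prompt_def by blast
qed

section \<open>Mechanism welfare and optimum on the hard instances\<close>

lemma mechanism_total_welfare_le:
  assumes D: "feasible n m D" "truthful n m D" "individually_rational n m D" "prompt n m D"
    and C: "3 \<le> C" "k + 1 \<le> C" and R: "R = C ^ k" "R \<le> n" "R \<le> m"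
  shows "(\<Sum>l\<le>k. (\<Sum>a\<in>draws R R. welfare (profile C n a) (stock R m (C ^ l))
      (outcome D (profile C n a) (stock R m (C ^ l)))) / 2 ^ l) \<le> 16 * real (card (draws R R))"
proof -
  let ?N = "\<lambda>l. stock R m (C ^ l)" and ?b = "profile C n"
  \<comment> \<open>\<open>H\<close>: buyer \<open>i\<close> has been priced by stage \<open>l\<close>; \<open>p\<close> is that price, arbitrary as long as there is none.
    A buyer whose value equals her price may be served late or never, so level \<open>\<sigma>\<close> itself is not forced.\<close>
  define S where "S l a i \<longleftrightarrow> served (edges (?N l)) (outcome D (?b a) (?N l)) i" for l a i
  define H where "H l a i \<longleftrightarrow> (\<exists>x<R. S l (a[i := x]) i)" for l a i
  define p where "p a i = pay D (?b (a[i := SOME x. x < R \<and> S k (a[i := x]) i])) (?N k) i" for a i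
  define \<sigma> where "\<sigma> a i = (SOME \<sigma>. \<sigma> \<le> k \<and> (\<forall>s<\<sigma>. p a i < wt C s)
    \<and> (\<forall>s\<le>k. p a i \<le> wt C s \<longrightarrow> s \<le> \<sigma>))" for a i
  have \<sigma>: "\<sigma> a i \<le> k" "\<And>s. s < \<sigma> a i \<Longrightarrow> p a i < wt C s"
    "\<And>s. s \<le> k \<Longrightarrow> p a i \<le> wt C s \<Longrightarrow> s \<le> \<sigma> a i" for a i
    using someI_ex[OF price_level_exists[OF C(1), of k "p a i"]] unfolding \<sigma>_def[symmetric] by blast+
  have t: "C ^ l \<le> C ^ k" "C ^ l \<le> m" if "l \<le> k" for l
  proof -
    show "C ^ l \<le> C ^ k" using that C by (intro power_increasing) auto
    then show "C ^ l \<le> m" using R by simp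
  qed
  have N: "?N l \<in> arrivals n m" if "l \<le> k" for l
    using t[OF that] R by (intro stock_arrivals)
  have b: "?b a \<in> profiles n" if "a \<in> draws R R" for a
    using that R by (intro profile_profiles) (simp add: draws_def)
  have S_mono: "S k a i" "pay D (?b a) (?N l) i = pay D (?b a) (?N k) i"
    if "l \<le> k" "a \<in> draws R R" "S l a i" for l a i
    using served_stock_mono[OF D(1,4) b[OF that(2)] t(1)[OF that(1)], where R = R and i = i]
      that R unfolding S_def by auto
  \<comment> \<open>Promptness carries the payment from stage \<open>l\<close> to stage
    \<open>k\<close>, truthfulness from \<open>x\<close> to the chosen winning draw
    \<open>y\<close>; so the price depends on neither.\<close>
  have price: "pay D (?b (a[i := x])) (?N l) i = p a i"
    if "l \<le> k" "a \<in> draws R R" "i < R" "x < R" "S l (a[i := x]) i" for l a i x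
  proof -
    have Sx: "S k (a[i := x]) i" "pay D (?b (a[i := x])) (?N l) i = pay D (?b (a[i := x])) (?N k) i"
      using S_mono[OF that(1) _ that(5)] that draws_update by auto
    define y where "y = (SOME x. x < R \<and> S k (a[i := x]) i)"
    have y: "y < R \<and> S k (a[i := y]) i"
      unfolding y_def by (rule someI[of _ x]) (use Sx that in auto)
    have "pay D (?b (a[i := x])) (?N k) i = pay D (?b (a[i := y])) (?N k) i"
      using served_pay_unique[OF D(2) N b[OF that(2)], of k i "wt C (lev C x)" "wt C (lev C y)"]
        Sx y that R unfolding S_def by (simp add: profile_update draws_def wt_nonneg)
    then show ?thesis
      using Sx by (simp add: p_def y_def)
  qed
  have "(\<Sum>l\<le>k. (\<Sum>a\<in>draws R R. \<Sum>i<R. wt C (lev C (a ! i)) * of_bool (S l a i)) / 2 ^ l)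
      \<le> 16 * real (card (draws R R))"
  proof (rule total_welfare_le[OF C R(1), where H = H and \<sigma> = \<sigma>])
    show "H l (a[i := x]) i = H l a i" for l a i x
      by (simp add: H_def)
    show "\<sigma> (a[i := x]) i = \<sigma> a i" for a i x
      by (simp add: \<sigma>_def p_def)
    show "\<sigma> a i \<le> k" for a i
      by (rule \<sigma>)
    show "card {i. i < R \<and> S l a i} \<le> C ^ l" if "l \<le> k" "a \<in> draws R R" for l a
      unfolding S_def by (rule card_served_stock[OF D(1) b t(2)]) (use that R in auto)
  next
    fix l a i assume *: "l \<le> k" "a \<in> draws R R" "i < R" "S l a i"
    have a: "a ! i < R" "i < length a"
      using * draws_nth_less by (auto simp: draws_def)
    have "pay D (?b a) (?N l) i = p a i"
      using price[of l a i "a ! i"] * a by simp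
    moreover have "pay D (?b a) (?N l) i \<le> ?b a ! i"
      using * R unfolding S_def by (intro pay_le_report[OF D(3) N b]) auto
    ultimately have "p a i \<le> wt C (lev C (a ! i))"
      using a by (simp add: profile_nth)
    then have "lev C (a ! i) \<le> \<sigma> a i"
      using a R by (intro \<sigma> lev_le) auto
    moreover have "H l a i"
      unfolding H_def using * a by (intro exI[of _ "a ! i"]) simp
    ultimately show "H l a i \<and> lev C (a ! i) \<le> \<sigma> a i" by simp
  next
    fix l a i assume *: "l \<le> k" "a \<in> draws R R" "i < R" "H l a i" "lev C (a ! i) < \<sigma> a i"
    then obtain x where x: "x < R" "S l (a[i := x]) i"
      by (auto simp: H_def)
    have "i < length a" using * by (simp add: draws_def)
    \<comment> \<open>The winning draw \<open>x\<close> reveals a price below the buyer's value, so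
      her own report must win at the same stage \<open>l\<close>.\<close>
    have "pay D (?b (a[i := x])) (?N l) i < wt C (lev C (a ! i))"
      using price[OF *(1,2,3) x] \<sigma>(2)[OF *(5)] by simp
    then have "served (edges (?N l)) (outcome D ((?b (a[i := x]))[i := wt C (lev C (a ! i))]) (?N l)) i"
      using x * R draws_update[OF *(2) x(1)] unfolding S_def
      by (intro served_above_price[OF D(1,2) N b]) auto
    then show "S l a i"
      using \<open>i < length a\<close> unfolding S_def by (simp flip: profile_update)
  qed
  then show ?thesis
    using R by (simp add: S_def welfare_profile draws_def)
qed

text \<open>The witness matching serves as many buyers of level at most \<open>l\<close> as the
  supply permits, each worth at least \<open>wt C l\<close>.\<close>

lemma opt_stock_ge:
  assumes "3 \<le> C" "length a = R" "R \<le> n" "C ^ l \<le> m"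
  shows "wt C l * min (real C ^ l) (\<Sum>i<R. of_bool (a ! i < C ^ l))
    \<le> opt (profile C n a) (stock R m (C ^ l))"
proof -
  let ?N = "stock R m (C ^ l)"
  let ?c = "min (C ^ l) (card {i. i < R \<and> a ! i < C ^ l})"
  obtain T where T: "T \<subseteq> {i. i < R \<and> a ! i < C ^ l}" "card T = ?c" "finite T"
    using obtain_subset_with_card_n[OF min.cobounded2] by blast
  then obtain h where h: "bij_betw h T {..<?c}"
    using ex_bij_betw_finite_nat[of T] unfolding atLeast0LessThan by auto
  define \<mu> where "\<mu> = (\<lambda>i. (i, h i)) ` T"
  have sub: "\<mu> \<subseteq> edges ?N"
    unfolding \<mu>_def edges_stock[OF assms(4)] using T(1) bij_betwE[OF h] by fastforce
  then have "is_matching (edges ?N) \<mu>"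
    using h by (auto simp: is_matching_def \<mu>_def bij_betw_def inj_on_def)
  have fin: "finite {welfare (profile C n a) ?N \<mu> | \<mu>. is_matching (edges ?N) \<mu>}"
  proof (rule finite_subset)
    show "{welfare (profile C n a) ?N \<mu> | \<mu>. is_matching (edges ?N) \<mu>}
      \<subseteq> welfare (profile C n a) ?N ` Pow (edges ?N)"
      by (auto simp: is_matching_def)
  qed (use assms in \<open>simp add: edges_stock\<close>)
  have "{..<R} \<inter> {i. a ! i < C ^ l} = {i. i < R \<and> a ! i < C ^ l}"
    by auto
  then have "min (real C ^ l) (\<Sum>i<R. of_bool (a ! i < C ^ l)) = real (card T)"
    using T by (simp add: of_nat_min)
  then have "wt C l * min (real C ^ l) (\<Sum>i<R. of_bool (a ! i < C ^ l)) = (\<Sum>i\<in>T. wt C l)"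
    by simp
  also have "\<dots> \<le> (\<Sum>i\<in>T. wt C (lev C (a ! i)) * of_bool (served (edges ?N) \<mu> i))"
  proof (rule sum_mono)
    fix i assume i: "i \<in> T"
    then have "served (edges ?N) \<mu> i"
      using sub by (auto simp: served_def \<mu>_def)
    moreover have "wt C l \<le> wt C (lev C (a ! i))"
      using T i assms by (intro wt_antimono lev_le) auto
    ultimately show "wt C l \<le> wt C (lev C (a ! i)) * of_bool (served (edges ?N) \<mu> i)"
      by simp
  qed
  also have "\<dots> \<le> (\<Sum>i<R. wt C (lev C (a ! i)) * of_bool (served (edges ?N) \<mu> i))"
    using T by (intro sum_mono2) (auto simp: wt_nonneg)
  also have "\<dots> = welfare (profile C n a) ?N \<mu>"
    using assms by (simp add: welfare_profile)
  also have "\<dots> \<le> opt (profile C n a) ?N"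
    unfolding opt_def using \<open>is_matching (edges ?N) \<mu>\<close> by (intro Max_ge fin) auto
  finally show ?thesis .
qed

text \<open>By the second moment bound at \<open>t = C ^ l\<close>, at least
  \<open>C ^ l / 2\<close> buyers worth \<open>wt C l\<close> can be served on average, and
  \<open>C ^ l\<close> times \<open>wt C l\<close> is \<open>2 ^ l\<close>.\<close>

lemma sum_opt_stock_ge:
  assumes "3 \<le> C" "R = C ^ k" "R \<le> n" "R \<le> m" "l \<le> k"
  shows "2 ^ l * real (card (draws R R)) / 2
    \<le> (\<Sum>a\<in>draws R R. opt (profile C n a) (stock R m (C ^ l)))"
proof -
  have t: "C ^ l \<le> R" using assms by (auto intro: power_increasing)
  have "2 ^ l * real (card (draws R R)) / 2 = wt C l * (real (card (draws R R)) * real (C ^ l) / 2)"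
    using power_mult_wt[OF assms(1), of l] by (simp add: algebra_simps)
  also have "\<dots> \<le> wt C l * (\<Sum>a\<in>draws R R. min (real (C ^ l)) (\<Sum>i<R. of_bool (a ! i < C ^ l)))"
    using t assms by (intro mult_left_mono sum_draws_min_ge wt_nonneg) auto
  also have "\<dots> \<le> (\<Sum>a\<in>draws R R. opt (profile C n a) (stock R m (C ^ l)))"
    unfolding sum_distrib_left
  proof (rule sum_mono)
    fix a assume "a \<in> draws R R"
    then show "wt C l * min (real (C ^ l)) (\<Sum>i<R. of_bool (a ! i < C ^ l))
        \<le> opt (profile C n a) (stock R m (C ^ l))"
      using opt_stock_ge[OF assms(1), of a R n l m] t assms
      by (simp add: draws_def del: sum_of_bool_eq)
  qed
  finally show ?thesis .
qed

section \<open>The lower bound\<close>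

text \<open>The outcome is measurable into a discrete space, so every function of it is measurable;
  the welfare is also bounded.\<close>

lemma welfare_integrable:
  assumes "randomized_mechanism n m M" "v \<in> profiles n" "N \<in> arrivals n m"
  shows "integrable M (\<lambda>D. welfare v N (outcome D v N))"
proof -
  have M: "finite_measure M"
    using assms by (simp add: randomized_mechanism_def prob_space.finite_measure)
  have "(\<lambda>D. outcome D v N) \<in> M \<rightarrow>\<^sub>M count_space UNIV"
    using assms by (simp add: randomized_mechanism_def)
  then have [measurable]: "(\<lambda>D. welfare v N (outcome D v N)) \<in> borel_measurable M"
    by (rule measurable_compose) simp
  show ?thesis
  proof (rule finite_measure.integrable_const_bound[OF M, where B = "\<Sum>i<length v. \<bar>v ! i\<bar>"])
    show "AE D in M. norm (welfare v N (outcome D v N)) \<le> (\<Sum>i<length v. \<bar>v ! i\<bar>)"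
    proof (rule AE_I2)
      fix D
      have "norm (welfare v N (outcome D v N))
          \<le> (\<Sum>i<length v. norm (v ! i * of_bool (served (edges N) (outcome D v N) i)))"
        unfolding welfare_def by (rule norm_sum)
      also have "\<dots> \<le> (\<Sum>i<length v. \<bar>v ! i\<bar>)"
        by (intro sum_mono) (auto simp: of_bool_def)
      finally show "norm (welfare v N (outcome D v N)) \<le> (\<Sum>i<length v. \<bar>v ! i\<bar>)" .
    qed
  qed simp
qed

text \<open>Averaging argument: the prior over instances is fixed independently of the mechanism,
  with stage \<open>l\<close> weighted by \<open>1 / 2 ^ l\<close>. The welfare bound holds for each
  realization, hence for the mixture. The constant 32 is 16 from the welfare times 2 from the
  optimum.\<close>

lemma competitive_ge:
  assumes M: "prompt_truthful_mechanism n m M" and \<alpha>: "competitive n m M \<alpha>"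
    and C: "3 \<le> C" "k + 1 \<le> C" and R: "C ^ k \<le> min m n"
  shows "real (k + 1) / 32 \<le> \<alpha>"
proof -
  define R where "R = C ^ k"
  have Rle: "R \<le> n" "R \<le> m" using R by (auto simp: R_def)
  have rm: "randomized_mechanism n m M"
    using M by (simp add: prompt_truthful_mechanism_def)
  then have prob: "prob_space M" by (simp add: randomized_mechanism_def)
  then have const: "integrable M (\<lambda>D. c)" for c :: real
    by (intro finite_measure.integrable_const prob_space.finite_measure)
  let ?A = "draws R R" and ?N = "\<lambda>l. stock R m (C ^ l)" and ?b = "profile C n"
  let ?W = "\<lambda>l a D. welfare (?b a) (?N l) (outcome D (?b a) (?N l))"
  have N: "?N l \<in> arrivals n m" if "l \<le> k" for l
  proof (rule stock_arrivals)
    have "C ^ l \<le> C ^ k" using that C by (intro power_increasing) auto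
    then show "C ^ l \<le> m" using R by simp
  qed fact
  have b: "?b a \<in> profiles n" if "a \<in> ?A" for a
    using that Rle by (intro profile_profiles) (simp add: draws_def)
  have int: "integrable M (?W l a)" if "l \<le> k" "a \<in> ?A" for l a
    using that by (intro welfare_integrable[OF rm] b N)
  have A: "0 < card ?A"
    using C by (intro card_draws_pos) (simp add: R_def)
  have \<alpha>0: "0 \<le> \<alpha>" using \<alpha> by (simp add: competitive_def)
  have "real (k + 1) * (real (card ?A) / 2) = (\<Sum>l\<le>k. (2 ^ l * real (card ?A) / 2) / 2 ^ l)"
    by simp
  also have "\<dots> \<le> (\<Sum>l\<le>k. (\<Sum>a\<in>?A. opt (?b a) (?N l)) / 2 ^ l)"
    using sum_opt_stock_ge[OF C(1) R_def Rle] by (intro sum_mono divide_right_mono) auto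
  also have "\<dots> \<le> (\<Sum>l\<le>k. (\<Sum>a\<in>?A. \<alpha> * (\<integral>D. ?W l a D \<partial>M)) / 2 ^ l)"
    using \<alpha> b N by (intro sum_mono divide_right_mono) (auto simp: competitive_def)
  also have "\<dots> = \<alpha> * (\<integral>D. (\<Sum>l\<le>k. (\<Sum>a\<in>?A. ?W l a D) / 2 ^ l) \<partial>M)"
    using int by (simp add: sum_distrib_left)
  also have "\<dots> \<le> \<alpha> * (\<integral>D. 16 * real (card ?A) \<partial>M)"
  proof (intro mult_left_mono integral_mono \<alpha>0)
    show "integrable M (\<lambda>D. \<Sum>l\<le>k. (\<Sum>a\<in>?A. ?W l a D) / 2 ^ l)"
      using int by auto
    fix D assume "D \<in> space M"
    then have "feasible n m D" "truthful n m D" "individually_rational n m D" "prompt n m D"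
      using M by (auto simp: prompt_truthful_mechanism_def randomized_mechanism_def)
    then show "(\<Sum>l\<le>k. (\<Sum>a\<in>?A. ?W l a D) / 2 ^ l) \<le> 16 * real (card ?A)"
      using C R_def Rle by (rule mechanism_total_welfare_le)
  qed (rule const)
  also have "\<dots> = \<alpha> * (16 * real (card ?A))"
    by (simp add: prob_space.prob_space[OF prob])
  finally have "real (card ?A) * (real (k + 1) / 32) \<le> real (card ?A) * \<alpha>"
    by (simp add: field_simps)
  then show ?thesis
    using A by (simp only: mult_le_cancel_left_pos of_nat_0_less_iff)
qed

text \<open>For \<open>k\<close> the floor of \<open>L / ln L\<close>, the second bound ensures
  \<open>3 \<le> k + 1\<close> and the third \<open>k + 1 \<le> L\<close>.\<close>

lemma log_ratio_bounds:
  fixes L :: real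
  assumes "exp 2 \<le> L"
  shows "1 < L" "2 \<le> L / ln L" "L / ln L + 1 \<le> L"
proof -
  have "1 + 2 \<le> exp (2::real)" by (rule exp_ge_add_one_self)
  then have L: "3 \<le> L" using assms by simp
  then show "1 < L" by simp
  have lnL: "2 \<le> ln L"
    using assms L by (simp add: ln_ge_iff)
  \<comment> \<open>Passing to the square root sharpens \<open>ln_le_minus_one\<close>: the
    resulting bound \<open>4 * sqrt L - 4\<close> falls short of \<open>L\<close> by a
    square.\<close>
  have "ln L = 2 * ln (sqrt L)"
    using L by (simp add: ln_sqrt)
  also have "\<dots> \<le> 2 * (sqrt L - 1)"
    using L by (intro mult_left_mono ln_le_minus_one) auto
  finally have "2 * ln L \<le> 4 * sqrt L - 4" by simp
  also have "\<dots> \<le> L"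
    using zero_le_power2[of "sqrt L - 2"] L by (simp add: power2_diff)
  finally show "2 \<le> L / ln L"
    using lnL by (simp add: le_divide_eq)
  have "L / ln L \<le> L / 2"
    using lnL L by (intro divide_left_mono) auto
  then show "L / ln L + 1 \<le> L"
    using L by linarith
qed

theorem theorem5:
  "\<exists>c>0::real. \<exists>\<nu>\<^sub>0::nat. \<forall>(n::nat) (m::nat) (M :: mechanism measure).
     \<nu>\<^sub>0 \<le> min m n \<longrightarrow> prompt_truthful_mechanism n m M \<longrightarrow>
     ereal (c * (ln (real (min m n)) / ln (ln (real (min m n))))) \<le> competitive_ratio n m M"
proof -
  \<comment> \<open>The threshold \<open>exp (exp 2)\<close> makes \<open>L = ln \<nu>\<close> at
    least \<open>exp 2\<close>.\<close>
  have "ereal (1 / 32 * (ln (real (min m n)) / ln (ln (real (min m n))))) \<le> competitive_ratio n m M"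
    if \<nu>: "nat \<lceil>exp (exp 2 :: real)\<rceil> \<le> min m n" and M: "prompt_truthful_mechanism n m M" for n m M
    unfolding competitive_ratio_def
  proof (rule Inf_greatest, clarify)
    fix \<alpha> assume \<alpha>: "competitive n m M \<alpha>"
    define \<nu> where "\<nu> = min m n"
    define L where "L = ln (real \<nu>)"
    define k where "k = nat \<lfloor>L / ln L\<rfloor>"
    have "exp (exp 2) \<le> real \<nu>"
      using \<nu> unfolding \<nu>_def by linarith
    moreover from this have "0 < real \<nu>"
      using exp_gt_zero[of "exp 2 :: real"] by linarith
    ultimately have "exp 2 \<le> L"
      by (simp add: L_def ln_ge_iff)
    note L = log_ratio_bounds[OF this]
    have k: "2 \<le> k" "real k \<le> L / ln L" "L / ln L \<le> real (k + 1)"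
      using L unfolding k_def by linarith+
    \<comment> \<open>From \<open>k \<le> L / ln L\<close> and \<open>k + 1 \<le> L\<close> follows
      \<open>(k + 1) ^ k \<le> exp L = \<nu>\<close>, so the instance fits.\<close>
    have "ln (real (k + 1) ^ k) = real k * ln (real (k + 1))"
      by (simp add: ln_realpow)
    also have "\<dots> \<le> L / ln L * ln L"
      using k L by (intro mult_mono) auto
    also have "\<dots> = L"
      using L by simp
    finally have "real ((k + 1) ^ k) \<le> real \<nu>"
      using \<open>0 < real \<nu>\<close> by (simp add: L_def)
    then have "(k + 1) ^ k \<le> min m n"
      by (simp only: \<nu>_def of_nat_le_iff)
    then have "real (k + 1) / 32 \<le> \<alpha>"
      using k by (intro competitive_ge[OF M \<alpha>]) auto
    then show "ereal (1 / 32 * (ln (real (min m n)) / ln (ln (real (min m n))))) \<le> ereal \<alpha>"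
      using k(3) by (simp add: L_def \<nu>_def)
  qed
  then show ?thesis
    by (intro exI[of _ "1 / 32"] conjI exI[of _ "nat \<lceil>exp (exp 2 :: real)\<rceil>"]) auto
qed

end
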